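(* Let $G$ be a finite group, $H$ a proper subgroup of $G$, $S$ an inverse-closed subset of $G\setminus\{e\}$ such that $S\subset N_G(H)$, and $k$ a positive integer. Then $H$ is a $(0,k)$-regular set in $\mathrm{Cay}(G,S)$ if and only if there exists a $k$-covering $f:\mathrm{Cay}(G,S)\rightarrow K_n$ such that $H$ is a vertex-fiber of $f$, where $n=|G:H|$.
   Context: All groups are finite and all graphs are finite and simple. $e$ is the identity of $G$, $N_G(H)$ is the normalizer of $H$ in $G$, and $|G:H|$ is the index. A subset $S\subseteq G$ is inverse-closed if $S^{-1}=\{s^{-1}:s\in S\}=S$. For an inverse-closed $S\subseteq G\setminus\{e\}$, the Cayley graph $\mathrm{Cay}(G,S)$ has vertex set $G$ and edge set $\{\{x,y\}: x,y\in G,\ yx^{-1}\in S\}$. A $(0,k)$-regular set in a graph $\Gamma$ is a nonempty proper subset $D$ of $V(\Gamma)$ such that every vertex in $D$ has no neighbour in $D$ and every vertex in $V(\Gamma)\setminus D$ has exactly $k$ neighbours in $D$. A $k$-covering from a graph $\Gamma$ to a graph $\Sigma$ is a surjective graph homomorphism $f:\Gamma\to\Sigma$ such that $|N_\Gamma(u)\cap f^{-1}(y)|=k$ for any $\{x,y\}\in E(\Sigma)$ and $u\in f^{-1}(x)$, where $N_\Gamma(u)$ is the set of neighbours of $u$ in $\Gamma$; the sets $f^{-1}(x)$, $x\in V(\Sigma)$, are the vertex-fibers of $f$. $K_n$ is the complete graph on $n$ vertices. *)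

theory Defs
  imports "HOL-Algebra.Algebra" "Graph_Theory.Kuratowski"
begin

text \<open>
  A finite simple graph is a \<^locale>\<open>pair_graph\<close>: a symmetric loop-free digraph whose arcs are
  pairs, an undirected edge \<open>{x, y}\<close> being the two arcs \<open>(x, y)\<close> and \<open>(y, x)\<close>.
\<close>

definition neighbours :: "'a pair_pre_digraph \<Rightarrow> 'a \<Rightarrow> 'a set" where
  "neighbours \<Gamma> u = {v \<in> pverts \<Gamma>. (u, v) \<in> parcs \<Gamma>}"

definition vertex_fiber :: "'a pair_pre_digraph \<Rightarrow> ('a \<Rightarrow> 'b) \<Rightarrow> 'b \<Rightarrow> 'a set" where
  "vertex_fiber \<Gamma> f y = {u \<in> pverts \<Gamma>. f u = y}"

definition graph_hom :: "'a pair_pre_digraph \<Rightarrow> 'b pair_pre_digraph \<Rightarrow> ('a \<Rightarrow> 'b) \<Rightarrow> bool" where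
  "graph_hom \<Gamma> \<Delta> f \<longleftrightarrow>
     f \<in> pverts \<Gamma> \<rightarrow> pverts \<Delta> \<and> (\<forall>(u, v) \<in> parcs \<Gamma>. (f u, f v) \<in> parcs \<Delta>)"

definition covering :: "nat \<Rightarrow> 'a pair_pre_digraph \<Rightarrow> 'b pair_pre_digraph \<Rightarrow> ('a \<Rightarrow> 'b) \<Rightarrow> bool" where
  "covering k \<Gamma> \<Delta> f \<longleftrightarrow>
     graph_hom \<Gamma> \<Delta> f \<and> f ` pverts \<Gamma> = pverts \<Delta> \<and>
     (\<forall>(x, y) \<in> parcs \<Delta>. \<forall>u \<in> vertex_fiber \<Gamma> f x.
        card (neighbours \<Gamma> u \<inter> vertex_fiber \<Gamma> f y) = k)"

definition zero_regular_set :: "nat \<Rightarrow> 'a pair_pre_digraph \<Rightarrow> 'a set \<Rightarrow> bool" where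
  "zero_regular_set k \<Gamma> D \<longleftrightarrow>
     D \<noteq> {} \<and> D \<subset> pverts \<Gamma> \<and>
     (\<forall>u \<in> D. neighbours \<Gamma> u \<inter> D = {}) \<and>
     (\<forall>u \<in> pverts \<Gamma> - D. card (neighbours \<Gamma> u \<inter> D) = k)"

definition complete_graph :: "nat \<Rightarrow> nat pair_pre_digraph" where
  "complete_graph n = \<lparr>pverts = {..<n}, parcs = {(i, j). i < n \<and> j < n \<and> i \<noteq> j}\<rparr>"

definition cayley_graph :: "('a, 'b) monoid_scheme \<Rightarrow> 'a set \<Rightarrow> 'a pair_pre_digraph" where
  "cayley_graph G S =
     \<lparr>pverts = carrier G,
      parcs = {(x, y). x \<in> carrier G \<and> y \<in> carrier G \<and> y \<otimes>\<^bsub>G\<^esub> inv\<^bsub>G\<^esub> x \<in> S}\<rparr>"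

lemma complete_graph_complete_digraph: "complete_digraph n (with_proj (complete_graph n))"
  by (auto simp: complete_digraph_pair_def complete_graph_def)

lemma pair_graph_cayley_graph:
  assumes "group G" "finite (carrier G)" "S \<subseteq> carrier G - {\<one>\<^bsub>G\<^esub>}" "set_inv\<^bsub>G\<^esub> S = S"
  shows "pair_graph (cayley_graph G S)"
proof -
  interpret group G by fact
  let ?C = "cayley_graph G S"
  have sub: "parcs ?C \<subseteq> carrier G \<times> carrier G"
    by (auto simp: cayley_graph_def)
  have sym: "(y, x) \<in> parcs ?C" if "(x, y) \<in> parcs ?C" for x y
  proof -
    have *: "x \<in> carrier G" "y \<in> carrier G" "y \<otimes>\<^bsub>G\<^esub> inv\<^bsub>G\<^esub> x \<in> S"
      using that by (auto simp: cayley_graph_def)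
    then have "inv\<^bsub>G\<^esub> (y \<otimes>\<^bsub>G\<^esub> inv\<^bsub>G\<^esub> x) \<in> S"
      using assms(4) by (auto simp: SET_INV_def)
    with * show ?thesis
      by (simp add: cayley_graph_def inv_mult_group)
  qed
  show ?thesis
  proof
    show "finite (parcs ?C)"
      using sub assms(2) by (meson finite_SigmaI finite_subset)
    show "symmetric (with_proj ?C)"
      using sym by (auto simp: symmetric_def intro: symI)
    show "fst e \<noteq> snd e" if "e \<in> parcs ?C" for e
      using that assms(3) by (auto simp: cayley_graph_def)
  qed (use assms(2) in \<open>auto simp: cayley_graph_def\<close>)
qed

end

theory Submission
  imports Defs
begin

text \<open>
  Right translations are automorphisms of the Cayley graph, and they permute the right cosets of
  \<open>H\<close>. Hence if \<open>H\<close> is a \<open>(0, k)\<close>-regular set then so is every right coset of \<open>H\<close>, and sending a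
  vertex to its coset is a \<open>k\<close>-covering of a complete graph. Conversely, every fiber of a
  \<open>k\<close>-covering of a complete graph is independent, and has \<open>k\<close> neighbours of each outside vertex.
\<close>

lemma pverts_cayley_graph [simp]: "pverts (cayley_graph G S) = carrier G"
  by (simp add: cayley_graph_def)

lemma parcs_cayley_graph_iff:
  "(x, y) \<in> parcs (cayley_graph G S) \<longleftrightarrow>
     x \<in> carrier G \<and> y \<in> carrier G \<and> y \<otimes>\<^bsub>G\<^esub> inv\<^bsub>G\<^esub> x \<in> S"
  by (simp add: cayley_graph_def)

lemma pverts_complete_graph [simp]: "pverts (complete_graph n) = {..<n}"
  by (simp add: complete_graph_def)

lemma parcs_complete_graph_iff [simp]:
  "(i, j) \<in> parcs (complete_graph n) \<longleftrightarrow> i < n \<and> j < n \<and> i \<noteq> j"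
  by (simp add: complete_graph_def)

text \<open>An arc inside the fiber would map to a loop at \<open>x\<close>, which a complete graph
  lacks. A vertex outside the fiber lies over some vertex different from \<open>x\<close>, hence
  adjacent to \<open>x\<close>, so the covering condition counts its neighbours in the fiber. The
  assumption \<open>proper\<close> excludes \<open>n = 1\<close>, where the only fiber is the whole
  vertex set.\<close>

lemma zero_regular_set_vertex_fiber:
  assumes cov: "covering k \<Gamma> (complete_graph n) f"
    and x: "x < n" and proper: "vertex_fiber \<Gamma> f x \<noteq> pverts \<Gamma>"
  shows "zero_regular_set k \<Gamma> (vertex_fiber \<Gamma> f x)"
  unfolding zero_regular_set_def
proof (intro conjI ballI)
  have arcs: "(f u, f v) \<in> parcs (complete_graph n)" if "(u, v) \<in> parcs \<Gamma>" for u v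
    using cov that by (auto simp: covering_def graph_hom_def)
  have img: "f ` pverts \<Gamma> = {..<n}"
    using cov by (simp add: covering_def)
  have count: "card (neighbours \<Gamma> u \<inter> vertex_fiber \<Gamma> f z) = k"
    if "(y, z) \<in> parcs (complete_graph n)" "u \<in> vertex_fiber \<Gamma> f y" for y z u
    using cov that unfolding covering_def by blast
  have "x \<in> f ` pverts \<Gamma>"
    using img x by simp
  then show "vertex_fiber \<Gamma> f x \<noteq> {}"
    by (auto simp: vertex_fiber_def)
  show "vertex_fiber \<Gamma> f x \<subset> pverts \<Gamma>"
    using proper by (auto simp: vertex_fiber_def)
  show "neighbours \<Gamma> u \<inter> vertex_fiber \<Gamma> f x = {}" if "u \<in> vertex_fiber \<Gamma> f x" for u
    using that arcs by (fastforce simp: neighbours_def vertex_fiber_def)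
  show "card (neighbours \<Gamma> u \<inter> vertex_fiber \<Gamma> f x) = k"
    if u: "u \<in> pverts \<Gamma> - vertex_fiber \<Gamma> f x" for u
  proof (rule count)
    have "f u < n"
      using img u by auto
    then show "(f u, x) \<in> parcs (complete_graph n)"
      using x u by (auto simp: vertex_fiber_def)
    show "u \<in> vertex_fiber \<Gamma> f (f u)"
      using u by (simp add: vertex_fiber_def)
  qed
qed

context group
begin

text \<open>The factor \<open>g\<close> cancels in the quotient that decides adjacency.\<close>

lemma parcs_cayley_graph_translate:
  assumes "x \<in> carrier G" "y \<in> carrier G" "g \<in> carrier G"
  shows "(x \<otimes> g, y \<otimes> g) \<in> parcs (cayley_graph G S) \<longleftrightarrow> (x, y) \<in> parcs (cayley_graph G S)"
proof -
  have "(y \<otimes> g) \<otimes> inv (x \<otimes> g) = y \<otimes> inv x"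
    using assms by (metis inv_closed inv_mult_group m_assoc m_closed r_inv r_one)
  then show ?thesis
    using assms by (simp add: parcs_cayley_graph_iff)
qed

text \<open>Right translation by \<open>g\<close> is injective, carries \<open>H\<close> onto
  \<open>H #> g\<close>, and carries neighbours of \<open>u \<otimes> inv g\<close> to neighbours of
  \<open>u\<close>. Counts in any right coset thus reduce to counts in \<open>H\<close>.\<close>

lemma card_neighbours_cayley_graph_rcoset:
  assumes H: "H \<subseteq> carrier G" and u: "u \<in> carrier G" and g: "g \<in> carrier G"
  shows "card (neighbours (cayley_graph G S) u \<inter> (H #> g)) =
         card (neighbours (cayley_graph G S) (u \<otimes> inv g) \<inter> H)"
proof -
  let ?N = "neighbours (cayley_graph G S)"
  have arc: "(u, h \<otimes> g) \<in> parcs (cayley_graph G S) \<longleftrightarrow>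
      (u \<otimes> inv g, h) \<in> parcs (cayley_graph G S)" if "h \<in> H" for h
    using parcs_cayley_graph_translate[of "u \<otimes> inv g" h g S] that H u g
    by (auto simp: m_assoc)
  have "?N u \<inter> (H #> g) = (\<lambda>h. h \<otimes> g) ` (?N (u \<otimes> inv g) \<inter> H)"
    using H g arc by (auto simp: neighbours_def r_coset_def)
  moreover have "inj_on (\<lambda>h. h \<otimes> g) (?N (u \<otimes> inv g) \<inter> H)"
    using H g by (intro inj_onI) (metis IntD2 right_cancel subsetD)
  ultimately show ?thesis
    by (simp add: card_image)
qed

lemma rcos_eq_iff:
  assumes "subgroup H G" "x \<in> carrier G" "y \<in> carrier G"
  shows "H #> x = H #> y \<longleftrightarrow> x \<otimes> inv y \<in> H"
proof -
  have "H #> x = H #> y \<longleftrightarrow> x \<in> H #> y"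
    using assms by (metis repr_independence rcos_self)
  also have "\<dots> \<longleftrightarrow> x \<otimes> inv y \<in> H"
    using assms subgroup.rcos_module[OF assms(1) is_group] by blast
  finally show ?thesis .
qed

lemma covering_of_zero_regular_subgroup:
  assumes fin: "finite (carrier G)" and H: "subgroup H G"
    and reg: "zero_regular_set k (cayley_graph G S) H"
  shows "\<exists>f. covering k (cayley_graph G S) (complete_graph (card (rcosets H))) f \<and>
    (\<exists>x < card (rcosets H). H = vertex_fiber (cayley_graph G S) f x)"
proof -
  let ?\<Gamma> = "cayley_graph G S" and ?n = "card (rcosets H)"
  note HG = subgroup.subset[OF H]
  have "rcosets H = (\<lambda>x. H #> x) ` carrier G"
    by (auto simp: RCOSETS_def)
  \<comment> \<open>The vertices of \<open>complete_graph\<close> are natural numbers, so the cosets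
    have to be numbered; any numbering serves.\<close>
  then obtain e where e: "bij_betw e ((\<lambda>x. H #> x) ` carrier G) {..<?n}"
    using fin by (metis ex_bij_betw_finite_nat finite_imageI atLeast0LessThan)
  define f where "f u = e (H #> u)" for u
  have f_eq: "f u = f v \<longleftrightarrow> u \<otimes> inv v \<in> H" if "u \<in> carrier G" "v \<in> carrier G" for u v
    using that bij_betw_imp_inj_on[OF e] rcos_eq_iff[OF H that]
    by (auto simp: f_def inj_on_def)
  have f_img: "f ` carrier G = {..<?n}"
    using bij_betw_imp_surj_on[OF e] by (simp add: f_def image_image)
  have fiber: "vertex_fiber ?\<Gamma> f (f v) = H #> v" if "v \<in> carrier G" for v
    using that f_eq HG subgroup.rcos_module[OF H is_group that] r_coset_subset_G[OF HG that]
    by (auto simp: vertex_fiber_def)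
  \<comment> \<open>An arc within one coset, translated by \<open>inv u\<close>, becomes an arc from
    \<open>\<one>\<close> to \<open>v \<otimes> inv u\<close>. Both ends lie in \<open>H\<close>,
    against the independence of \<open>H\<close>.\<close>
  have indep: "f u \<noteq> f v" if uv: "(u, v) \<in> parcs ?\<Gamma>" for u v
  proof
    assume eq: "f u = f v"
    have c: "u \<in> carrier G" "v \<in> carrier G"
      using uv by (auto simp: parcs_cayley_graph_iff)
    have "v \<otimes> inv u \<in> H"
      using f_eq c eq by metis
    moreover have "(\<one>, v \<otimes> inv u) \<in> parcs ?\<Gamma>"
      using parcs_cayley_graph_translate[of u v "inv u" S] c uv by simp
    ultimately have "v \<otimes> inv u \<in> neighbours ?\<Gamma> \<one> \<inter> H"
      using c by (simp add: neighbours_def)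
    then show False
      using reg subgroup.one_closed[OF H] by (auto simp: zero_regular_set_def)
  qed
  have "covering k ?\<Gamma> (complete_graph ?n) f"
    unfolding covering_def graph_hom_def
  proof (intro conjI)
    show "f \<in> pverts ?\<Gamma> \<rightarrow> pverts (complete_graph ?n)"
      using f_img by auto
    show "\<forall>(u, v) \<in> parcs ?\<Gamma>. (f u, f v) \<in> parcs (complete_graph ?n)"
      using indep f_img by (auto simp: parcs_cayley_graph_iff)
    show "f ` pverts ?\<Gamma> = pverts (complete_graph ?n)"
      using f_img by simp
    have "card (neighbours ?\<Gamma> u \<inter> vertex_fiber ?\<Gamma> f y) = k"
      if xy: "(x, y) \<in> parcs (complete_graph ?n)" and u: "u \<in> vertex_fiber ?\<Gamma> f x" for x y u
    proof -
      have "y \<in> f ` carrier G"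
        using f_img xy by simp
      then obtain g where g: "g \<in> carrier G" "y = f g"
        by blast
      have uG: "u \<in> carrier G" "f u = x"
        using u by (auto simp: vertex_fiber_def)
      \<comment> \<open>As \<open>x \<noteq> y\<close>, the vertices \<open>u\<close> and
        \<open>g\<close> lie in different cosets. So \<open>u \<otimes> inv g\<close> has
        \<open>k\<close> neighbours in \<open>H\<close>, and translating back by \<open>g\<close>
        gives \<open>u\<close> as many in \<open>H #> g\<close>, the fiber over
        \<open>y\<close>.\<close>
      then have "u \<otimes> inv g \<in> carrier G - H"
        using g xy f_eq by auto
      then show ?thesis
        using reg card_neighbours_cayley_graph_rcoset[OF HG uG(1) g(1)] fiber g
        by (simp add: zero_regular_set_def)
    qed
    then show "\<forall>(x, y) \<in> parcs (complete_graph ?n). \<forall>u \<in> vertex_fiber ?\<Gamma> f x.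
        card (neighbours ?\<Gamma> u \<inter> vertex_fiber ?\<Gamma> f y) = k"
      by blast
  qed
  \<comment> \<open>\<open>H\<close> is its own coset, represented by \<open>\<one>\<close>.\<close>
  moreover have "H = vertex_fiber ?\<Gamma> f (f \<one>)"
    using fiber HG by simp
  moreover have "f \<one> < ?n"
    using f_img by auto
  ultimately show ?thesis
    by blast
qed

end

theorem theorem2p6:
  fixes G :: "('a, 'b) monoid_scheme" and H S :: "'a set" and k n :: nat
  assumes "group G" and "finite (carrier G)"
    and "subgroup H G" and "H \<noteq> carrier G"
    and "S \<subseteq> carrier G - {\<one>\<^bsub>G\<^esub>}" and "set_inv\<^bsub>G\<^esub> S = S"
    and "S \<subseteq> normalizer G H"
    and "k > 0"
    and "n = card (rcosets\<^bsub>G\<^esub> H)"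
  shows "zero_regular_set k (cayley_graph G S) H \<longleftrightarrow>
    (\<exists>f. covering k (cayley_graph G S) (complete_graph n) f \<and>
      (\<exists>x \<in> pverts (complete_graph n). H = vertex_fiber (cayley_graph G S) f x))"
proof -
  interpret group G by fact
  show ?thesis
  proof
    assume "zero_regular_set k (cayley_graph G S) H"
    from covering_of_zero_regular_subgroup[OF assms(2,3) this] assms(9)
    show "\<exists>f. covering k (cayley_graph G S) (complete_graph n) f \<and>
      (\<exists>x \<in> pverts (complete_graph n). H = vertex_fiber (cayley_graph G S) f x)"
      by auto
  next
    assume "\<exists>f. covering k (cayley_graph G S) (complete_graph n) f \<and>
      (\<exists>x \<in> pverts (complete_graph n). H = vertex_fiber (cayley_graph G S) f x)"
    \<comment> \<open>\<open>H \<noteq> carrier G\<close> says that the fiber \<open>H\<close> is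
      proper.\<close>
    then show "zero_regular_set k (cayley_graph G S) H"
      using zero_regular_set_vertex_fiber assms(4) by fastforce
  qed
qed

end
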